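(* For complete reputation system settings (with both positive and negative feedbacks), there is no social reputation rule that satisfies all three of the postulates $T_c$, $M_c$, $G_c$. Relaxing any one of these postulates allows generating appropriate social rankings, that is: there is a social reputation rule satisfying $G_c$ and $T_c$; there is a social reputation rule satisfying $G_c$ and $M_c$; and there is a social reputation rule (defined on some nonempty class of settings) satisfying $T_c$ and $M_c$.
   Context: A complete reputation system setting $G$ consists of a finite set $V$ of agents together with two sets $E_g,E_b\subseteq V^2$ of directed edges without self-loops, the positive feedbacks $E_g$ and the negative feedbacks $E_b$. For $v\in V$ let $R_g(v)=\{u\in V:(u,v)\in E_g\}$ (agents giving positive feedback on $v$) and $R_b(v)=\{u\in V:(u,v)\in E_b\}$ (agents giving negative feedback on $v$). A social ranking of $G$ is a function $S(G):V\to\{1,\dots,|V|\}$ (not necessarily injective). Write $v_i\ge v_j$ if $S(G)(v_i)\le S(G)(v_j)$ (so a smaller number means ranked higher), and $v_i>v_j$ if $v_i\ge v_j$ but not $v_j\ge v_i$. As usual $v\le w$ means $w\ge v$, and $v<w$ means $w>v$. A social reputation rule $S$ assigns to each complete reputation system setting $G$ in some nonempty class of settings (its domain) a social ranking $S(G)$ of $V$. Given $G$ and $S(G)$, for sets $A,B\subseteq V$: $A$ is more important (equivalently, more reliable) than $B$ if there is an injective map $f:B\to A$ such that $v\le f(v)$ for every $v\in B$, and either $f$ is not onto or there is at least one $v\in B$ with $v<f(v)$. $A$ and $B$ are equally important (equivalently, have the same reliability) if there is a bijection $f:B\to A$ such that $v$ and $f(v)$ have the same rank for every $v\in B$. $A$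 is less reliable than $B$ if $B$ is more reliable than $A$. $R(v_i)$ is socially stronger than $R(v_j)$ if (1) $R_b(v_i)$ is less reliable than, or has the same reliability as, $R_b(v_j)$, and (2) $R_g(v_i)$ is more important than, or equally important as, $R_g(v_j)$, with at least one of the two comparisons strict (i.e. "less reliable" holds in (1) or "more important" holds in (2)). Postulates for a rule $S$: - $G_c$ (Generality): $S$ is defined on every complete reputation system setting. - $T_c$ (Transitivity): for every $G$ in the domain of $S$, with respect to $S(G)$: for all $v_i,v_j\in V$, if $R(v_i)$ is socially stronger than $R(v_j)$ then $v_i>v_j$. - $M_c$ (Weak Monotonicity): for every $G$ in the domain of $S$, with respect to $S(G)$: for all $v_i,v_j\in V$, if $R(v_i)$ is not socially stronger than $R(v_j)$ but $v_i>v_j$, then either there are $v_1\in R_g(v_i)$, $v_1'\in R_g(v_j)$ with $v_1>v_1'$, or there are $v_2\in R_b(v_i)$, $v_2'\in R_b(v_j)$ with $v_2<v_2'$. *)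

theory Defs
  imports Main "HOL-Library.FuncSet"
begin

record 'a setting =
  agents :: "'a set"
  pos_feedback :: "('a \<times> 'a) set"
  neg_feedback :: "('a \<times> 'a) set"

text \<open>Positive and negative feedback are not required to be disjoint.\<close>

definition complete_setting :: "'a setting \<Rightarrow> bool" where
  "complete_setting G \<longleftrightarrow>
     finite (agents G) \<and>
     pos_feedback G \<subseteq> agents G \<times> agents G \<and> irrefl (pos_feedback G) \<and>
     neg_feedback G \<subseteq> agents G \<times> agents G \<and> irrefl (neg_feedback G)"

definition R_g :: "'a setting \<Rightarrow> 'a \<Rightarrow> 'a set" where
  "R_g G v = {u \<in> agents G. (u, v) \<in> pos_feedback G}"

definition R_b :: "'a setting \<Rightarrow> 'a \<Rightarrow> 'a set" where
  "R_b G v = {u \<in> agents G. (u, v) \<in> neg_feedback G}"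

definition social_ranking :: "'a setting \<Rightarrow> ('a \<Rightarrow> nat) \<Rightarrow> bool" where
  "social_ranking G r \<longleftrightarrow> r \<in> agents G \<rightarrow>\<^sub>E {1..card (agents G)}"

text \<open>A smaller rank number is a higher position, so the comparison of agents reverses
  the order of the numbers.\<close>

definition ranked_ge :: "('a \<Rightarrow> nat) \<Rightarrow> 'a \<Rightarrow> 'a \<Rightarrow> bool" where
  "ranked_ge r v w \<longleftrightarrow> r v \<le> r w"

definition ranked_gt :: "('a \<Rightarrow> nat) \<Rightarrow> 'a \<Rightarrow> 'a \<Rightarrow> bool" where
  "ranked_gt r v w \<longleftrightarrow> ranked_ge r v w \<and> \<not> ranked_ge r w v"

text \<open>``More reliable'' and ``of the same reliability'' are synonyms of the following two.\<close>

definition more_important :: "('a \<Rightarrow> nat) \<Rightarrow> 'a set \<Rightarrow> 'a set \<Rightarrow> bool" where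
  "more_important r A B \<longleftrightarrow>
     (\<exists>f. f \<in> B \<rightarrow> A \<and> inj_on f B \<and> (\<forall>v\<in>B. ranked_ge r (f v) v) \<and>
          (f ` B \<noteq> A \<or> (\<exists>v\<in>B. ranked_gt r (f v) v)))"

definition equally_important :: "('a \<Rightarrow> nat) \<Rightarrow> 'a set \<Rightarrow> 'a set \<Rightarrow> bool" where
  "equally_important r A B \<longleftrightarrow> (\<exists>f. bij_betw f B A \<and> (\<forall>v\<in>B. r v = r (f v)))"

definition less_reliable :: "('a \<Rightarrow> nat) \<Rightarrow> 'a set \<Rightarrow> 'a set \<Rightarrow> bool" where
  "less_reliable r A B \<longleftrightarrow> more_important r B A"

definition socially_stronger :: "'a setting \<Rightarrow> ('a \<Rightarrow> nat) \<Rightarrow> 'a \<Rightarrow> 'a \<Rightarrow> bool" where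
  "socially_stronger G r v w \<longleftrightarrow>
     (less_reliable r (R_b G v) (R_b G w) \<or> equally_important r (R_b G v) (R_b G w)) \<and>
     (more_important r (R_g G v) (R_g G w) \<or> equally_important r (R_g G v) (R_g G w)) \<and>
     (less_reliable r (R_b G v) (R_b G w) \<or> more_important r (R_g G v) (R_g G w))"

text \<open>A rule is a partial map; the class of settings on which it is defined is its \<open>dom\<close>.\<close>

type_synonym 'a rule = "'a setting \<rightharpoonup> ('a \<Rightarrow> nat)"

definition social_reputation_rule :: "'a rule \<Rightarrow> bool" where
  "social_reputation_rule S \<longleftrightarrow>
     dom S \<noteq> {} \<and> (\<forall>G r. S G = Some r \<longrightarrow> complete_setting G \<and> social_ranking G r)"

definition generality :: "'a rule \<Rightarrow> bool" where
  "generality S \<longleftrightarrow> (\<forall>G. complete_setting G \<longrightarrow> G \<in> dom S)"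

definition transitivity :: "'a rule \<Rightarrow> bool" where
  "transitivity S \<longleftrightarrow>
     (\<forall>G r. S G = Some r \<longrightarrow>
        (\<forall>v\<in>agents G. \<forall>w\<in>agents G. socially_stronger G r v w \<longrightarrow> ranked_gt r v w))"

definition weak_monotonicity :: "'a rule \<Rightarrow> bool" where
  "weak_monotonicity S \<longleftrightarrow>
     (\<forall>G r. S G = Some r \<longrightarrow>
        (\<forall>v\<in>agents G. \<forall>w\<in>agents G.
           \<not> socially_stronger G r v w \<and> ranked_gt r v w \<longrightarrow>
             (\<exists>x\<in>R_g G v. \<exists>y\<in>R_g G w. ranked_gt r x y) \<or>
             (\<exists>x\<in>R_b G v. \<exists>y\<in>R_b G w. ranked_gt r y x)))"

end

theory Submission
  imports Defs Complex_Main
begin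

text \<open>
  Impossibility: if nobody rates \<open>v\<close>, and both \<open>w\<close> and \<open>w'\<close> have the negative
  feedback \<open>{c}\<close> and some positive feedback, then weak monotonicity can never witness a strict
  comparison with \<open>v\<close>, so \<open>v\<close>, \<open>w\<close> and \<open>w'\<close> are ranked
  equally; but transitivity separates \<open>w\<close> from \<open>w'\<close> as soon as the positive feedback of
  \<open>w'\<close> properly contains that of \<open>w\<close>.

  Generality and transitivity: rank the agents by a positive solution \<open>x\<close> of
  \<open>x v = 1 + \<epsilon> * (sum x (R_g G v) - sum x (R_b G v))\<close>. For small \<open>\<epsilon> > 0\<close> such a solution is given
  by a Neumann series, and, \<open>x\<close> being positive, sums of \<open>x\<close> respect the importance of sets.

  The other two pairs of postulates are satisfied by ranking all agents equally, where for the
  last pair the domain is cut down to settings without feedback.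
\<close>

section \<open>Neumann series for a signed score\<close>

text \<open>The operator taking \<open>e\<close> to
  \<open>\<epsilon> * (sum e (P v) - sum e (Q v))\<close> shrinks uniform bounds by a factor of 4.
  Its iterates on the constant 1 are therefore summable, and those after the first add up to at most
  1/3 in absolute value, too little to cancel the leading 1.\<close>

lemma positive_signed_score_exists:
  fixes P Q :: "'a \<Rightarrow> 'a set"
  assumes "finite V" and P: "\<And>v. P v \<subseteq> V" and Q: "\<And>v. Q v \<subseteq> V"
  obtains x :: "'a \<Rightarrow> real" and \<epsilon> :: real
  where "\<epsilon> > 0" and "\<And>v. x v > 0"
    and "\<And>v. x v = 1 + \<epsilon> * (sum x (P v) - sum x (Q v))"
proof -
  \<comment> \<open>Two sums of at most \<open>card V\<close> terms cost a factor of at most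
    \<open>2 * (card V + 1)\<close>; the 8 turns this into 1/4. The \<open>+ 1\<close> covers an
    empty \<open>V\<close>.\<close>
  define \<epsilon> :: real where "\<epsilon> = 1 / (8 * (real (card V) + 1))"
  have "\<epsilon> > 0" by (simp add: \<epsilon>_def add_pos_nonneg)
  define d where
    "d = rec_nat (\<lambda>_. 1 :: real) (\<lambda>_ e v. \<epsilon> * (sum e (P v) - sum e (Q v)))"
  have d_0: "d 0 v = 1" for v by (simp add: d_def)
  have d_Suc: "d (Suc k) v = \<epsilon> * (sum (d k) (P v) - sum (d k) (Q v))" for k v
    by (simp add: d_def)
  have d_bound: "\<bar>d k v\<bar> \<le> (1/4) ^ k" for k v
  proof (induction k arbitrary: v)
    case 0
    then show ?case by (simp add: d_0)
  next
    case (Suc k)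
    have sum_bound: "\<bar>sum (d k) A\<bar> \<le> (real (card V) + 1) * (1/4) ^ k" if "A \<subseteq> V" for A
    proof -
      have "\<bar>sum (d k) A\<bar> \<le> (\<Sum>u\<in>A. \<bar>d k u\<bar>)" by (rule sum_abs)
      also have "\<dots> \<le> real (card A) * (1/4) ^ k" by (rule sum_bounded_above) (rule Suc.IH)
      also have "\<dots> \<le> (real (card V) + 1) * (1/4) ^ k"
        using card_mono[OF \<open>finite V\<close> that] by (intro mult_right_mono) auto
      finally show ?thesis .
    qed
    have "\<bar>d (Suc k) v\<bar> = \<epsilon> * \<bar>sum (d k) (P v) - sum (d k) (Q v)\<bar>"
      using \<open>\<epsilon> > 0\<close> by (simp add: d_Suc abs_mult)
    also have "\<dots> \<le> \<epsilon> * (2 * ((real (card V) + 1) * (1/4) ^ k))"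
      using sum_bound[OF P[of v]] sum_bound[OF Q[of v]] \<open>\<epsilon> > 0\<close>
      by (intro mult_left_mono) linarith+
    also have "\<dots> = \<epsilon> * (8 * (real (card V) + 1)) * (1/4) ^ Suc k" by simp
    also have "\<epsilon> * (8 * (real (card V) + 1)) = 1"
      by (simp add: \<epsilon>_def add_nonneg_eq_0_iff)
    finally show ?case by simp
  qed
  have geom: "summable (\<lambda>k. (1/4 :: real) ^ k)" by (rule summable_geometric) simp
  have summ: "summable (\<lambda>k. d k v)" for v
    by (rule summable_comparison_test[OF _ geom]) (use d_bound in auto)
  define x where "x v = (\<Sum>k. d k v)" for v
  have head: "x v = 1 + (\<Sum>k. d (Suc k) v)" for v
    using suminf_split_head[OF summ[of v]] by (simp add: x_def d_0)
  have "x v > 0" for v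
  proof -
    \<comment> \<open>The negated geometric tail bounds the tail of the series below by -1/3, so
      \<open>x v\<close> is at least 2/3.\<close>
    have "(\<lambda>k. 1/4 * (1/4 :: real) ^ k) sums (1/4 * (1 / (1 - 1/4)))"
      by (intro sums_mult geometric_sums) simp
    then have tail: "(\<lambda>k. (1/4 :: real) ^ Suc k) sums (1/3)" by simp
    have "(\<Sum>k. - ((1/4 :: real) ^ Suc k)) \<le> (\<Sum>k. d (Suc k) v)"
    proof (rule suminf_le)
      show "- ((1/4) ^ Suc k) \<le> d (Suc k) v" for k
        using d_bound[of "Suc k" v] by linarith
      show "summable (\<lambda>k. - ((1/4 :: real) ^ Suc k))"
        using sums_minus[OF tail] by (rule sums_summable)
      show "summable (\<lambda>k. d (Suc k) v)"
        using summ[of v] by (subst summable_Suc_iff)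
    qed
    then show ?thesis
      using head[of v] sums_unique[OF sums_minus[OF tail]] by simp
  qed
  moreover have "x v = 1 + \<epsilon> * (sum x (P v) - sum x (Q v))" for v
  proof -
    have sum_x: "(\<lambda>k. sum (d k) A) sums sum x A" for A
      unfolding x_def by (intro sums_sum summable_sums summ)
    \<comment> \<open>Finite sums pass through the series, so the operator merely shifts its index
      by one.\<close>
    have "(\<lambda>k. d (Suc k) v) sums (\<epsilon> * (sum x (P v) - sum x (Q v)))"
      unfolding d_Suc by (intro sums_mult sums_diff sum_x)
    then show ?thesis using head[of v] by (simp add: sums_iff)
  qed
  ultimately show thesis using that \<open>\<epsilon> > 0\<close> by blast
qed

section \<open>Rankings induced by scores\<close>

text \<open>Take one plus the number of agents with a strictly larger score, so that ties share a
  rank.\<close>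

lemma ranking_by_score_exists:
  fixes x :: "'a \<Rightarrow> 'b :: linorder"
  assumes fin: "finite (agents G)"
  obtains r where "social_ranking G r"
    and "\<And>v w. v \<in> agents G \<Longrightarrow> w \<in> agents G \<Longrightarrow> r v \<le> r w \<longleftrightarrow> x w \<le> x v"
proof
  define above where "above v = {u \<in> agents G. x v < x u}" for v
  define r where "r = (\<lambda>v\<in>agents G. Suc (card (above v)))"
  \<comment> \<open>No agent is above itself, which leaves room for the \<open>Suc\<close>.\<close>
  have less: "card (above v) < card (agents G)" if "v \<in> agents G" for v
    using that fin by (intro psubset_card_mono) (auto simp: above_def)
  show "social_ranking G r"
    using less by (auto simp: social_ranking_def r_def Suc_le_eq)
  fix v w assume v: "v \<in> agents G" and w: "w \<in> agents G"
  have "card (above v) \<le> card (above w)" if "x w \<le> x v"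
    using that fin by (intro card_mono) (auto simp: above_def)
  moreover have "card (above w) < card (above v)" if "x v < x w"
    using that fin w by (intro psubset_card_mono) (auto simp: above_def)
  ultimately show "r v \<le> r w \<longleftrightarrow> x w \<le> x v"
    using v w by (auto simp: r_def not_le[symmetric])
qed

context
  fixes r :: "'a \<Rightarrow> nat" and x :: "'a \<Rightarrow> real" and V :: "'a set"
  assumes fin: "finite V" and pos: "\<And>v. v \<in> V \<Longrightarrow> x v > 0"
    and rank: "\<And>v w. v \<in> V \<Longrightarrow> w \<in> V \<Longrightarrow> r v \<le> r w \<longleftrightarrow> x w \<le> x v"
begin

lemma more_important_sum_less:
  assumes "A \<subseteq> V" "B \<subseteq> V" "more_important r A B"
  shows "sum x B < sum x A"
proof -
  obtain f where f: "f \<in> B \<rightarrow> A" "inj_on f B" "\<forall>v\<in>B. ranked_ge r (f v) v"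
    and strict: "f ` B \<noteq> A \<or> (\<exists>v\<in>B. ranked_gt r (f v) v)"
    using assms(3) unfolding more_important_def by blast
  have finite: "finite A" "finite B"
    using assms(1,2) fin by (auto intro: finite_subset)
  have inV: "v \<in> V" "f v \<in> V" if "v \<in> B" for v
    using that f(1) assms(1,2) by auto
  have le: "x v \<le> x (f v)" if "v \<in> B" for v
    using f(3) that rank[OF inV(2,1)[OF that]] by (auto simp: ranked_ge_def)
  have image: "sum x (f ` B) = (\<Sum>v\<in>B. x (f v))"
    using sum.reindex[OF f(2), of x] by simp
  have posA: "x a > 0" if "a \<in> A" for a using pos that assms(1) by blast
  have sub: "f ` B \<subseteq> A" using f(1) by auto
  have 1: "sum x B \<le> (\<Sum>v\<in>B. x (f v))" using le by (rule sum_mono)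
  have 2: "sum x (f ` B) \<le> sum x A"
    using sum_mono2[OF finite(1) sub] posA by (auto intro: less_imp_le)
  from strict show ?thesis
  proof
    assume "f ` B \<noteq> A"
    then obtain a where a: "a \<in> A" "a \<notin> f ` B" using sub by blast
    have "sum x (f ` B) < sum x A"
      using sum_strict_mono2[OF finite(1) sub, of a x] a posA by (auto intro: less_imp_le)
    then show ?thesis using 1 image by simp
  next
    assume "\<exists>v\<in>B. ranked_gt r (f v) v"
    then obtain v where v: "v \<in> B" "ranked_gt r (f v) v" by blast
    have "x v < x (f v)"
      using v(2) rank[OF inV[OF v(1)]] by (auto simp: ranked_gt_def ranked_ge_def)
    then have "sum x B < (\<Sum>v\<in>B. x (f v))"
      using le v(1) finite by (intro sum_strict_mono_ex1) auto
    then show ?thesis using 2 image by simp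
  qed
qed

lemma equally_important_sum_eq:
  assumes "A \<subseteq> V" "B \<subseteq> V" "equally_important r A B"
  shows "sum x B = sum x A"
proof -
  obtain f where f: "bij_betw f B A" "\<forall>v\<in>B. r v = r (f v)"
    using assms(3) unfolding equally_important_def by blast
  have "x v = x (f v)" if "v \<in> B" for v
  proof -
    have "v \<in> V" "f v \<in> V" using that assms(1,2) bij_betwE[OF f(1)] by auto
    then show ?thesis
      using rank[of v "f v"] rank[of "f v" v] f(2) that by auto
  qed
  then have "sum x B = (\<Sum>v\<in>B. x (f v))" by simp
  also have "\<dots> = sum x A" using f(1) by (rule sum.reindex_bij_betw)
  finally show ?thesis .
qed

end

section \<open>Generality with transitivity\<close>

lemma R_subset_agents: "R_g G v \<subseteq> agents G" "R_b G v \<subseteq> agents G"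
  by (auto simp: R_g_def R_b_def)

lemma transitive_ranking_exists:
  assumes "complete_setting G"
  shows "\<exists>r. social_ranking G r \<and>
    (\<forall>v\<in>agents G. \<forall>w\<in>agents G. socially_stronger G r v w \<longrightarrow> ranked_gt r v w)"
proof -
  have fin: "finite (agents G)" using assms by (simp add: complete_setting_def)
  obtain x :: "'a \<Rightarrow> real" and \<epsilon> where "\<epsilon> > 0" and pos: "\<And>v. x v > 0"
    and x: "\<And>v. x v = 1 + \<epsilon> * (sum x (R_g G v) - sum x (R_b G v))"
    using positive_signed_score_exists[of "agents G" "R_g G" "R_b G", OF fin R_subset_agents]
    by metis
  obtain r where "social_ranking G r"
    and rank: "\<And>v w. v \<in> agents G \<Longrightarrow> w \<in> agents G \<Longrightarrow> r v \<le> r w \<longleftrightarrow> x w \<le> x v"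
    using ranking_by_score_exists[OF fin, where x = x] by blast
  moreover have "ranked_gt r v w"
    if "v \<in> agents G" "w \<in> agents G" and stronger: "socially_stronger G r v w" for v w
  proof -
    have less: "more_important r A B \<Longrightarrow> sum x B < sum x A"
      and eq: "equally_important r A B \<Longrightarrow> sum x B = sum x A"
      if "A \<subseteq> agents G" "B \<subseteq> agents G" for A B
      using more_important_sum_less[OF fin pos rank that] equally_important_sum_eq[OF fin pos rank that]
      by simp_all
    note less_g = less[OF R_subset_agents(1) R_subset_agents(1), of v w]
      and eq_g = eq[OF R_subset_agents(1) R_subset_agents(1), of v w]
      and less_b = less[OF R_subset_agents(2) R_subset_agents(2), of w v]
      and eq_b = eq[OF R_subset_agents(2) R_subset_agents(2), of v w]
    \<comment> \<open>One fact per conjunct of \<open>socially_stronger\<close>; the third supplies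
      the strictness of the net score.\<close>
    have "sum x (R_b G v) < sum x (R_b G w) \<or> sum x (R_b G v) = sum x (R_b G w)"
      "sum x (R_g G w) < sum x (R_g G v) \<or> sum x (R_g G w) = sum x (R_g G v)"
      "sum x (R_b G v) < sum x (R_b G w) \<or> sum x (R_g G w) < sum x (R_g G v)"
      using stronger less_g eq_g less_b eq_b
      unfolding socially_stronger_def less_reliable_def by metis+
    then have "sum x (R_g G w) - sum x (R_b G w) < sum x (R_g G v) - sum x (R_b G v)"
      by linarith
    then have "x w < x v"
      using x[of v] x[of w] \<open>\<epsilon> > 0\<close> by simp
    then show ?thesis
      using rank[of v w] rank[of w v] that(1,2) by (simp add: ranked_gt_def ranked_ge_def)
  qed
  ultimately show ?thesis by blast
qed

definition empty_setting :: "'a setting" where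
  "empty_setting = \<lparr>agents = {}, pos_feedback = {}, neg_feedback = {}\<rparr>"

lemma complete_empty_setting: "complete_setting empty_setting"
  by (simp add: complete_setting_def empty_setting_def irrefl_def)

lemma generality_dom_nonempty: "generality S \<Longrightarrow> dom S \<noteq> {}"
  using complete_empty_setting by (auto simp: generality_def)

text \<open>Transitivity constrains each setting separately, so a suitable ranking can be chosen
  setting by setting.\<close>

lemma general_transitive_rule_exists:
  "\<exists>S :: 'a rule. social_reputation_rule S \<and> generality S \<and> transitivity S"
proof -
  define good :: "'a setting \<Rightarrow> ('a \<Rightarrow> nat) \<Rightarrow> bool" where
    "good G r \<longleftrightarrow> social_ranking G r \<and>
      (\<forall>v\<in>agents G. \<forall>w\<in>agents G. socially_stronger G r v w \<longrightarrow> ranked_gt r v w)" for G r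
  define S :: "'a rule" where
    "S G = (if complete_setting G then Some (SOME r. good G r) else None)" for G
  have "good G r" if "S G = Some r" for G r
  proof -
    have "complete_setting G" and r: "r = (SOME r. good G r)"
      using that by (auto simp: S_def split: if_splits)
    then have "\<exists>r. good G r"
      using transitive_ranking_exists by (simp add: good_def)
    then show ?thesis unfolding r by (rule someI_ex)
  qed
  moreover have "complete_setting G" if "S G = Some r" for G r
    using that by (simp add: S_def split: if_splits)
  moreover have "generality S" by (auto simp: generality_def S_def)
  ultimately have "social_reputation_rule S \<and> generality S \<and> transitivity S"
    using generality_dom_nonempty[of S]
    unfolding social_reputation_rule_def transitivity_def good_def by blast
  then show ?thesis by blast
qed

section \<open>Rules that tie all agents\<close>

definition constant_ranking :: "'a setting \<Rightarrow> 'a \<Rightarrow> nat" where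
  "constant_ranking G = (\<lambda>v\<in>agents G. 1)"

lemma social_ranking_constant_ranking:
  "complete_setting G \<Longrightarrow> social_ranking G (constant_ranking G)"
  by (auto simp: complete_setting_def social_ranking_def constant_ranking_def
      Suc_le_eq card_gt_0_iff)

lemma general_monotone_rule_exists:
  "\<exists>S :: 'a rule. social_reputation_rule S \<and> generality S \<and> weak_monotonicity S"
proof -
  define S :: "'a rule" where
    "S G = (if complete_setting G then Some (constant_ranking G) else None)" for G
  have "generality S" by (auto simp: generality_def S_def)
  moreover from this have "social_reputation_rule S"
    using social_ranking_constant_ranking generality_dom_nonempty[of S]
    by (auto simp: social_reputation_rule_def S_def split: if_splits)
  moreover have "weak_monotonicity S"
    by (auto simp: weak_monotonicity_def S_def constant_ranking_def ranked_gt_def ranked_ge_def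
        split: if_splits)
  ultimately show ?thesis by blast
qed

text \<open>Only an empty \<open>B\<close> maps into the empty set, and that map is onto with no
  agent to improve.\<close>

lemma not_more_important_empty: "\<not> more_important r {} B"
  by (auto simp: more_important_def)

text \<open>Without feedback nobody is socially stronger than anybody, so transitivity is vacuous;
  the ties make weak monotonicity vacuous.\<close>

lemma transitive_monotone_rule_exists:
  "\<exists>S :: 'a rule. social_reputation_rule S \<and> transitivity S \<and> weak_monotonicity S"
proof -
  define S :: "'a rule" where
    "S G = (if complete_setting G \<and> pos_feedback G = {} \<and> neg_feedback G = {}
            then Some (constant_ranking G) else None)" for G
  have "S empty_setting \<noteq> None"
    using complete_empty_setting by (simp add: S_def) (simp add: empty_setting_def)
  then have "dom S \<noteq> {}" by (metis domIff empty_iff)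
  then have "social_reputation_rule S"
    using social_ranking_constant_ranking
    unfolding social_reputation_rule_def by (auto simp: S_def split: if_splits)
  moreover have "transitivity S"
    by (auto simp: transitivity_def S_def socially_stronger_def less_reliable_def R_g_def R_b_def
        not_more_important_empty split: if_splits)
  moreover have "weak_monotonicity S"
    by (auto simp: weak_monotonicity_def S_def constant_ranking_def ranked_gt_def ranked_ge_def
        split: if_splits)
  ultimately show ?thesis by blast
qed

section \<open>Incompatibility of the three postulates\<close>

lemma not_more_or_equally_important_empty:
  assumes "B \<noteq> {}"
  shows "\<not> (more_important r {} B \<or> equally_important r {} B)"
  using assms by (auto simp: not_more_important_empty equally_important_def bij_betw_def)

text \<open>Either witness for weak monotonicity would need a rater of \<open>v\<close>. Nor does
  social strength excuse a strict comparison: \<open>v\<close> fails on the positive side and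
  \<open>w\<close> on the negative side.\<close>

lemma monotone_unrated_same_rank:
  assumes mono: "weak_monotonicity S" and S: "S G = Some r"
    and agents: "v \<in> agents G" "w \<in> agents G"
    and v: "R_g G v = {}" "R_b G v = {}" and w: "R_g G w \<noteq> {}" "R_b G w \<noteq> {}"
  shows "r v = r w"
proof -
  have "\<not> socially_stronger G r v w"
    using not_more_or_equally_important_empty[OF w(1), of r] v
    by (auto simp: socially_stronger_def)
  moreover have "\<not> socially_stronger G r w v"
    using not_more_or_equally_important_empty[OF w(2), of r] w(2) v
    by (auto simp: socially_stronger_def less_reliable_def equally_important_def bij_betw_def)
  ultimately have "\<not> ranked_gt r v w" "\<not> ranked_gt r w v"
    using mono S agents v unfolding weak_monotonicity_def by blast+
  then show ?thesis by (auto simp: ranked_gt_def ranked_ge_def)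
qed

lemma equally_important_refl: "equally_important r A A"
  unfolding equally_important_def by (rule exI[of _ id]) simp

lemma psubset_more_important:
  assumes "B \<subset> A"
  shows "more_important r A B"
  unfolding more_important_def by (rule exI[of _ id]) (use assms in \<open>auto simp: ranked_ge_def\<close>)

lemma no_transitive_monotone_general_rule:
  assumes inf: "infinite (UNIV :: 'a set)"
  shows "\<nexists>S :: 'a rule. transitivity S \<and> weak_monotonicity S \<and> generality S"
proof
  assume "\<exists>S :: 'a rule. transitivity S \<and> weak_monotonicity S \<and> generality S"
  then obtain S :: "'a rule"
    where trans: "transitivity S" and mono: "weak_monotonicity S" and gen: "generality S"
    by blast
  obtain v :: 'a where True by blast
  obtain c where c: "c \<notin> {v}" using ex_new_if_finite[OF inf, of "{v}"] by auto
  obtain w where w: "w \<notin> {v, c}" using ex_new_if_finite[OF inf, of "{v, c}"] by auto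
  obtain w' where w': "w' \<notin> {v, c, w}" using ex_new_if_finite[OF inf, of "{v, c, w}"] by auto
  \<comment> \<open>\<open>w\<close> doubles as the additional positive rater of \<open>w'\<close>,
    while \<open>c\<close> is the shared negative rater.\<close>
  define G where "G = \<lparr>agents = {v, c, w, w'}, pos_feedback = {(v, w), (v, w'), (w, w')},
    neg_feedback = {(c, w), (c, w')}\<rparr>"
  have "complete_setting G"
    using c w w' by (auto simp: complete_setting_def G_def irrefl_def)
  then obtain r where r: "S G = Some r" using gen unfolding generality_def by blast
  have R: "R_g G v = {}" "R_b G v = {}" "R_g G w = {v}" "R_b G w = {c}"
    "R_g G w' = {v, w}" "R_b G w' = {c}"
    using c w w' by (auto simp: R_g_def R_b_def G_def)
  have agents: "v \<in> agents G" "w \<in> agents G" "w' \<in> agents G" by (auto simp: G_def)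
  have "r v = r w" "r v = r w'"
    by (rule monotone_unrated_same_rank[OF mono r]; simp add: agents R)+
  moreover have "{v} \<subset> {v, w}" using w by auto
  then have "socially_stronger G r w' w"
    by (simp add: socially_stronger_def R equally_important_refl psubset_more_important)
  then have "ranked_gt r w' w"
    using trans r agents unfolding transitivity_def by blast
  ultimately show False by (simp add: ranked_gt_def ranked_ge_def)
qed

theorem theorem4:
  assumes "infinite (UNIV :: 'a set)"
  shows
    "(\<nexists>S :: 'a rule. social_reputation_rule S \<and>
        transitivity S \<and> weak_monotonicity S \<and> generality S) \<and>
     (\<exists>S :: 'a rule. social_reputation_rule S \<and> generality S \<and> transitivity S) \<and>
     (\<exists>S :: 'a rule. social_reputation_rule S \<and> generality S \<and> weak_monotonicity S) \<and>
     (\<exists>S :: 'a rule. social_reputation_rule S \<and> transitivity S \<and> weak_monotonicity S)"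
  using no_transitive_monotone_general_rule[OF assms] general_transitive_rule_exists
    general_monotone_rule_exists transitive_monotone_rule_exists
  by blast

end
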